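(* Let $F_{0,5}$ be the $0$-eigenspace of $\delta\circ\sigma$ on the order-$5$ part of $H^*(\mathrm{D}^\infty\mathrm{W}_1)$, and let $V$ be the subspace of $F_{0,5}$ which consists of elements of type $(2,2)$. Then $V\cong\mathbb{R}$, and the class of $h_{(1)}h_{(2)}c_{(0)}c_{(2)}$ generates $V$.
   Context: Let $\widetilde{\mathrm{D}^\infty\mathrm{W}}_1=\bigwedge[h_{(i)}]_{i\ge0}\otimes\mathbb{R}[c_{(j)}]_{j\ge0}$, with $h_{(i)}$ odd of degree 1, $c_{(j)}$ even of degree 2, and differential (signed derivation) $dh_{(i)}=c_{(i)}$, $dc_{(i)}=0$. The order is the additive grading with $\mathrm{ord}(h_{(i)})=\mathrm{ord}(c_{(i)})=i$. Let $\widetilde\delta,\widetilde\sigma$ be the unsigned derivations with $\widetilde\delta(c_{(i)})=c_{(i+1)}$, $\widetilde\delta(h_{(i)})=h_{(i+1)}$, $\widetilde\sigma(c_{(i)})=\frac12i(i-1)c_{(i-1)}$, $\widetilde\sigma(h_{(i)})=\frac12i(i-1)h_{(i-1)}$ (zero for $i=0$). Set $\mathrm{D}^\infty\mathrm{W}_1=\widetilde{\mathrm{D}^\infty\mathrm{W}}_1/\mathscr{I}$, where $\mathscr{I}$ is the ideal generated by $\widetilde\delta^k(c_{(0)}^2)$, $k\ge0$. The derivations $\widetilde\delta,\widetilde\sigma$ preserve $\mathscr{I}$ and commute with $d$; they induce derivations $\delta,\sigma$ of $H^*(\mathrm{D}^\infty\mathrm{W}_1)$. An element is of type $(a,b)$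 if it is a linear combination of monomials $h_{(i_1)}\cdots h_{(i_a)}c_{(j_1)}\cdots c_{(j_b)}$; a cohomology class is of type $(a,b)$ if it is represented by a cocycle of type $(a,b)$. *)

theory Defs
  imports Complex_Main "HOL-Library.Multiset" "HOL-Library.FSet"
begin

section \<open>The free graded-commutative algebra\<close>

text \<open>The algebra has the basis \<open>h\<^sub>S c\<^sub>M\<close>, where \<open>S\<close> is a finite set of indices
  (the factors \<open>h\<close> being multiplied in increasing order) and \<open>M\<close> is a finite multiset of
  indices. An element is its finitely supported coefficient function.\<close>

type_synonym idx = "nat fset \<times> nat multiset"

typedef gca = "{f :: idx \<Rightarrow> real. finite {m. f m \<noteq> 0}}"
  morphisms coeff Abs_gca
  by (rule exI[of _ "\<lambda>_. 0"]) simp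

setup_lifting type_definition_gca

instantiation gca :: real_vector
begin

lift_definition zero_gca :: gca is "\<lambda>_. 0" by simp

lift_definition plus_gca :: "gca \<Rightarrow> gca \<Rightarrow> gca" is "\<lambda>f g m. f m + g m"
  subgoal for f g by (rule finite_subset[of _ "{m. f m \<noteq> 0} \<union> {m. g m \<noteq> 0}"]) auto
  done

lift_definition uminus_gca :: "gca \<Rightarrow> gca" is "\<lambda>f m. - f m" by simp

lift_definition minus_gca :: "gca \<Rightarrow> gca \<Rightarrow> gca" is "\<lambda>f g m. f m - g m"
  subgoal for f g by (rule finite_subset[of _ "{m. f m \<noteq> 0} \<union> {m. g m \<noteq> 0}"]) auto
  done

lift_definition scaleR_gca :: "real \<Rightarrow> gca \<Rightarrow> gca" is "\<lambda>a f m. a * f m"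
  by (rule finite_subset) auto

instance
  by standard (transfer; simp add: fun_eq_iff algebra_simps)+

end

lift_definition mon :: "idx \<Rightarrow> gca" is "\<lambda>m n. if n = m then 1 else 0"
  by simp

definition lin :: "(idx \<Rightarrow> 'v::real_vector) \<Rightarrow> gca \<Rightarrow> 'v" where
  "lin f x = (\<Sum>m | coeff x m \<noteq> 0. coeff x m *\<^sub>R f m)"

lemma finite_coeff [simp]: "finite {m. coeff x m \<noteq> 0}"
  using coeff[of x] by simp

lemma lin_superset:
  assumes "finite A" "{m. coeff x m \<noteq> 0} \<subseteq> A"
  shows "lin f x = (\<Sum>m\<in>A. coeff x m *\<^sub>R f m)"
  unfolding lin_def using assms by (intro sum.mono_neutral_left) auto

lemma linear_lin: "linear (lin f)"
proof (rule linearI)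
  fix x y :: gca and r :: real
  let ?A = "{m. coeff x m \<noteq> 0} \<union> {m. coeff y m \<noteq> 0}"
  have "lin f (x + y) = (\<Sum>m\<in>?A. coeff (x + y) m *\<^sub>R f m)"
    by (rule lin_superset) (auto simp: plus_gca.rep_eq)
  also have "\<dots> = (\<Sum>m\<in>?A. coeff x m *\<^sub>R f m) + (\<Sum>m\<in>?A. coeff y m *\<^sub>R f m)"
    by (simp add: plus_gca.rep_eq scaleR_add_left sum.distrib)
  also have "\<dots> = lin f x + lin f y"
    by (subst (1 2) lin_superset[of ?A]) auto
  finally show "lin f (x + y) = lin f x + lin f y" .
  have "lin f (r *\<^sub>R x) = (\<Sum>m\<in>{m. coeff x m \<noteq> 0}. coeff (r *\<^sub>R x) m *\<^sub>R f m)"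
    by (rule lin_superset) (auto simp: scaleR_gca.rep_eq)
  then show "lin f (r *\<^sub>R x) = r *\<^sub>R lin f x"
    by (simp add: lin_def scaleR_gca.rep_eq scaleR_sum_right)
qed

lemma lin_mon [simp]: "lin f (mon m) = f m"
proof -
  have "lin f (mon m) = (\<Sum>n\<in>{m}. coeff (mon m) n *\<^sub>R f n)"
    by (rule lin_superset) (auto simp: mon.rep_eq)
  then show ?thesis by (simp add: mon.rep_eq)
qed

lemma coeff_sum: "coeff (\<Sum>i\<in>A. f i) m = (\<Sum>i\<in>A. coeff (f i) m)"
  by (induction A rule: infinite_finite_induct) (auto simp: zero_gca.rep_eq plus_gca.rep_eq)

lemma gca_expand: "lin mon x = x"
proof -
  have "coeff (lin mon x) n = coeff x n" for n
    by (auto simp: lin_def coeff_sum scaleR_gca.rep_eq mon.rep_eq if_distrib cong: if_cong)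
  then show ?thesis by (simp add: coeff_inject[symmetric] fun_eq_iff)
qed

lemma gca_induct [case_names add scale mon]:
  assumes "\<And>x y. P x \<Longrightarrow> P y \<Longrightarrow> P (x + y)" "\<And>r x. P x \<Longrightarrow> P (r *\<^sub>R x)" "\<And>m. P (mon m)"
  shows "P x"
proof -
  have 0: "P 0" using assms(2)[of "mon ({||},{#})" 0] assms(3) by simp
  have "P (\<Sum>m\<in>A. coeff x m *\<^sub>R mon m)" if "finite A" for A
    using that by (induction A rule: finite_induct) (auto intro: assms 0)
  then have "P (lin mon x)" unfolding lin_def by simp
  then show ?thesis by (simp add: gca_expand)
qed

text \<open>The sign of the permutation sorting the concatenation of two increasing sequences.\<close>

definition ssgn :: "nat fset \<Rightarrow> nat fset \<Rightarrow> real" where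
  "ssgn S T = (- 1) ^ card {(s, t). s |\<in>| S \<and> t |\<in>| T \<and> t < s}"

definition mon_mult :: "idx \<Rightarrow> idx \<Rightarrow> gca" where
  "mon_mult m n = (if fst m |\<inter>| fst n = {||}
     then ssgn (fst m) (fst n) *\<^sub>R mon (fst m |\<union>| fst n, snd m + snd n) else 0)"

lemma finite_pairs: "finite {(s, t). s |\<in>| S \<and> t |\<in>| T \<and> P s t}"
  by (rule finite_subset[of _ "fset S \<times> fset T"]) auto

lemma ssgn_union1: "S |\<inter>| T = {||} \<Longrightarrow> ssgn (S |\<union>| T) U = ssgn S U * ssgn T U"
proof -
  assume *: "S |\<inter>| T = {||}"
  have "{(s, t). s |\<in>| S |\<union>| T \<and> t |\<in>| U \<and> t < s} =
    {(s, t). s |\<in>| S \<and> t |\<in>| U \<and> t < s} \<union> {(s, t). s |\<in>| T \<and> t |\<in>| U \<and> t < s}" by auto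
  then show ?thesis
    unfolding ssgn_def using *
    by (auto simp: power_add[symmetric] intro!: arg_cong2[where f = power] card_Un_disjoint finite_pairs)
qed

lemma ssgn_union2: "S |\<inter>| T = {||} \<Longrightarrow> ssgn U (S |\<union>| T) = ssgn U S * ssgn U T"
proof -
  assume *: "S |\<inter>| T = {||}"
  have "{(s, t). s |\<in>| U \<and> t |\<in>| S |\<union>| T \<and> t < s} =
    {(s, t). s |\<in>| U \<and> t |\<in>| S \<and> t < s} \<union> {(s, t). s |\<in>| U \<and> t |\<in>| T \<and> t < s}" by auto
  then show ?thesis
    unfolding ssgn_def using *
    by (auto simp: power_add[symmetric] intro!: arg_cong2[where f = power] card_Un_disjoint finite_pairs)
qed

lemma ssgn_empty [simp]: "ssgn {||} T = 1" "ssgn T {||} = 1"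
  by (auto simp: ssgn_def)

instantiation gca :: real_algebra_1
begin

definition one_gca :: gca where "one_gca = mon ({||}, {#})"

definition times_gca :: "gca \<Rightarrow> gca \<Rightarrow> gca" where
  "times_gca x y = lin (\<lambda>m. lin (\<lambda>n. mon_mult m n) y) x"

lemma gca_add_left: "(x + y) * z = x * z + y * (z::gca)"
  by (simp add: times_gca_def linear_add[OF linear_lin])

lemma gca_scale_left: "(r *\<^sub>R x) * z = r *\<^sub>R (x * (z::gca))"
  by (simp add: times_gca_def linear_scale[OF linear_lin])

lemma gca_add_right: "z * (x + y) = z * x + z * (y::gca)"
  by (simp add: times_gca_def linear_add[OF linear_lin] lin_def[of _ z] scaleR_add_right sum.distrib)

lemma gca_scale_right: "z * (r *\<^sub>R x) = r *\<^sub>R (z * (x::gca))"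
  by (simp add: times_gca_def linear_scale[OF linear_lin] lin_def[of _ z] scaleR_sum_right mult.commute)

lemma mon_times: "mon m * mon n = mon_mult m n"
  by (simp add: times_gca_def)

lemma gca_zero_left: "0 * (x::gca) = 0"
  using gca_scale_left[of 0 0 x] by simp

lemma gca_zero_right: "x * (0::gca) = 0"
  using gca_scale_right[of x 0 0] by simp

lemma mon_assoc: "mon m * mon n * mon p = mon m * (mon n * mon p)"
proof -
  obtain S M T N U Q where [simp]: "m = (S, M)" "n = (T, N)" "p = (U, Q)"
    by (metis surj_pair)
  consider "S |\<inter>| T = {||}" "S |\<inter>| U = {||}" "T |\<inter>| U = {||}" |
    "S |\<inter>| T \<noteq> {||} \<or> S |\<inter>| U \<noteq> {||} \<or> T |\<inter>| U \<noteq> {||}" by blast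
  then show ?thesis
  proof cases
    case 1
    then show ?thesis
      by (simp add: mon_times mon_mult_def gca_scale_left gca_scale_right inf_sup_distrib1
          inf_sup_distrib2 ssgn_union1 ssgn_union2 sup_assoc add.assoc)
  next
    case 2
    then show ?thesis
      by (auto simp: mon_times mon_mult_def gca_scale_left gca_scale_right gca_zero_left
          gca_zero_right inf_sup_distrib1 inf_sup_distrib2)
  qed
qed

lemma gca_assoc: "x * y * z = x * (y * (z::gca))"
proof (induction x rule: gca_induct)
  case (mon m)
  show ?case
  proof (induction y rule: gca_induct)
    case (mon n)
    show ?case
      by (induction z rule: gca_induct) (simp_all add: gca_add_right gca_scale_right mon_assoc)
  qed (simp_all add: gca_add_left gca_scale_left gca_add_right gca_scale_right)
qed (simp_all add: gca_add_left gca_scale_left)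

instance
proof
  fix x y z :: gca and r :: real
  show "x * y * z = x * (y * z)" by (rule gca_assoc)
  show "(x + y) * z = x * z + y * z" by (rule gca_add_left)
  show "x * (y + z) = x * y + x * z" by (rule gca_add_right)
  show "(r *\<^sub>R x) * y = r *\<^sub>R (x * y)" by (rule gca_scale_left)
  show "x * (r *\<^sub>R y) = r *\<^sub>R (x * y)" by (rule gca_scale_right)
  show "1 * x = x"
    by (induction x rule: gca_induct)
      (simp_all add: one_gca_def gca_add_right gca_scale_right mon_times mon_mult_def)
  show "x * 1 = x"
    by (induction x rule: gca_induct)
      (simp_all add: one_gca_def gca_add_left gca_scale_left mon_times mon_mult_def)
  have "coeff 0 ({||}, {#}) \<noteq> coeff 1 ({||}, {#})"
    by (simp add: one_gca_def mon.rep_eq zero_gca.rep_eq)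
  then show "(0::gca) \<noteq> 1" by metis
qed

end

definition h :: "nat \<Rightarrow> gca" where "h i = mon ({|i|}, {#})"

definition c :: "nat \<Rightarrow> gca" where "c i = mon ({||}, {#i#})"

text \<open>The grading involution: multiplication by the sign given by the parity of the degree.\<close>

definition par :: "gca \<Rightarrow> gca" where
  "par = lin (\<lambda>m. (- 1) ^ fcard (fst m) *\<^sub>R mon m)"

lemma linear_par: "linear par" by (simp add: par_def linear_lin)

lemma par_mon: "par (mon m) = (- 1) ^ fcard (fst m) *\<^sub>R mon m" by (simp add: par_def)

lemma c_central: "c i * x = x * c i"
  by (induction x rule: gca_induct)
    (simp_all add: algebra_simps c_def mon_times mon_mult_def add.commute)

lemma c_left_commute: "y * (c i * x) = c i * (y * x)"
  by (metis c_central mult.assoc)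

lemma ssgn_swap: "i |\<notin>| S \<Longrightarrow> ssgn {|i|} S * ssgn S {|i|} = (- 1) ^ fcard S"
proof (induction S)
  case (insert j S)
  have "finsert j S = {|j|} |\<union>| S" by simp
  then have "ssgn {|i|} (finsert j S) * ssgn (finsert j S) {|i|} =
    (ssgn {|i|} {|j|} * ssgn {|j|} {|i|}) * (ssgn {|i|} S * ssgn S {|i|})"
    using insert.hyps ssgn_union1[of "{|j|}" S "{|i|}"] ssgn_union2[of "{|j|}" S "{|i|}"]
    by (simp add: mult_ac)
  moreover have "ssgn {|i|} {|j|} * ssgn {|j|} {|i|} = - 1"
  proof -
    have 1: "{(s, t). s |\<in>| {|i|} \<and> t |\<in>| {|j|} \<and> t < s} = (if j < i then {(i, j)} else {})"
      "{(s, t). s |\<in>| {|j|} \<and> t |\<in>| {|i|} \<and> t < s} = (if i < j then {(j, i)} else {})" by auto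
    show ?thesis unfolding ssgn_def 1 using insert.prems by auto
  qed
  ultimately show ?case using insert by (simp add: fcard_finsert_disjoint)
qed (simp add: fcard_fempty)

lemma h_comm: "h i * x = par x * h i"
proof (induction x rule: gca_induct)
  case (mon m)
  have "ssgn {|i|} (fst m) = (- 1) ^ fcard (fst m) * ssgn (fst m) {|i|}" if "i |\<notin>| fst m"
  proof -
    have "ssgn (fst m) {|i|} * ssgn (fst m) {|i|} = 1"
      by (simp add: ssgn_def power_add[symmetric])
    then show ?thesis using ssgn_swap[OF that] by (metis mult.assoc mult.right_neutral)
  qed
  then show ?case
    by (auto simp: h_def par_mon mon_times mon_mult_def)
qed (simp_all add: algebra_simps linear_add[OF linear_par] linear_scale[OF linear_par])


section \<open>Derivations\<close>

text \<open>The partial derivatives, on a basis monomial: \<open>h\<^sub>S = ssgn {i} S \<cdot> h\<^sub>i h\<^sub>S\<^sub>-\<^sub>i\<close> for \<open>i \<in> S\<close>.\<close>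

definition pdh :: "nat \<Rightarrow> idx \<Rightarrow> gca" where
  "pdh i m = (if i |\<in>| fst m then ssgn {|i|} (fst m) *\<^sub>R mon (fst m |-| {|i|}, snd m) else 0)"

definition pdc :: "nat \<Rightarrow> idx \<Rightarrow> gca" where
  "pdc i m = real (count (snd m) i) *\<^sub>R mon (fst m, snd m - {#i#})"

text \<open>The derivation with \<open>h i \<mapsto> f i\<close> and \<open>c i \<mapsto> g i\<close>. It is an unsigned derivation if the
  \<open>f i\<close> are odd and the \<open>g i\<close> are even, and a signed one if the \<open>f i\<close> are even and the \<open>g i\<close>
  vanish; these are the only cases used, see the Leibniz rules below.\<close>

definition deriv :: "(nat \<Rightarrow> gca) \<Rightarrow> (nat \<Rightarrow> gca) \<Rightarrow> gca \<Rightarrow> gca" where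
  "deriv f g = lin (\<lambda>m. (\<Sum>i\<in>fset (fst m). f i * pdh i m) + (\<Sum>i\<in>set_mset (snd m). g i * pdc i m))"

lemma linear_deriv: "linear (deriv f g)"
  by (simp add: deriv_def linear_lin)

lemma deriv_one [simp]: "deriv f g 1 = 0"
  by (simp add: deriv_def one_gca_def)

lemma deriv_mon:
  assumes "finite A" "fset (fst m) \<subseteq> A" "set_mset (snd m) \<subseteq> A"
  shows "deriv f g (mon m) = (\<Sum>i\<in>A. f i * pdh i m + g i * pdc i m)"
proof -
  have "(\<Sum>i\<in>fset (fst m). f i * pdh i m) = (\<Sum>i\<in>A. f i * pdh i m)"
    using assms by (intro sum.mono_neutral_left) (auto simp: pdh_def)
  moreover have "(\<Sum>i\<in>set_mset (snd m). g i * pdc i m) = (\<Sum>i\<in>A. g i * pdc i m)"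
    using assms by (intro sum.mono_neutral_left) (auto simp: pdc_def not_in_iff)
  ultimately show ?thesis by (simp add: deriv_def sum.distrib)
qed

lemma c_mon: "c i * mon m = mon (fst m, add_mset i (snd m))"
  by (simp add: c_def mon_times mon_mult_def)

lemma h_mon: "h i * mon m =
    (if i |\<in>| fst m then 0 else ssgn {|i|} (fst m) *\<^sub>R mon (finsert i (fst m), snd m))"
  by (auto simp: h_def mon_times mon_mult_def)

lemma pdh_c: "pdh j (fst m, add_mset i (snd m)) = c i * pdh j m"
  by (simp add: pdh_def c_mon)

lemma pdc_c: "pdc j (fst m, add_mset i (snd m)) = c i * pdc j m + (if i = j then mon m else 0)"
proof (cases "j \<in># snd m")
  case True
  then show ?thesis by (auto simp: pdc_def c_mon algebra_simps)
next
  case False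
  then show ?thesis by (auto simp: pdc_def c_mon not_in_iff)
qed

lemma deriv_c: "deriv f g (c i * x) = g i * x + c i * deriv f g x"
proof (induction x rule: gca_induct)
  case (mon m)
  define A where "A = insert i (fset (fst m) \<union> set_mset (snd m))"
  have "deriv f g (c i * mon m) =
    (\<Sum>j\<in>A. f j * (c i * pdh j m) + g j * (c i * pdc j m + (if i = j then mon m else 0)))"
    unfolding c_mon pdh_c[symmetric] pdc_c[symmetric] by (rule deriv_mon) (auto simp: A_def)
  also have "\<dots> = (\<Sum>j\<in>A. c i * (f j * pdh j m + g j * pdc j m)) + (\<Sum>j\<in>A. if i = j then g j * mon m else 0)"
    unfolding sum.distrib[symmetric]
    by (intro sum.cong refl) (auto simp: distrib_left c_left_commute)
  also have "(\<Sum>j\<in>A. if i = j then g j * mon m else 0) = g i * mon m"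
    by (simp add: A_def)
  also have "(\<Sum>j\<in>A. c i * (f j * pdh j m + g j * pdc j m)) = c i * deriv f g (mon m)"
    by (subst deriv_mon[of A]) (auto simp: A_def sum_distrib_left)
  finally show ?case by simp
qed (simp_all add: algebra_simps linear_add[OF linear_deriv] linear_scale[OF linear_deriv])

lemma ssgn_self: "ssgn {|i|} {|i|} = 1"
proof -
  have "{(s, t). s |\<in>| {|i|} \<and> t |\<in>| {|i|} \<and> t < s} = {}" by auto
  then show ?thesis by (simp only: ssgn_def) simp
qed

lemma ssgn_sq: "ssgn S T * ssgn S T = 1"
  by (simp add: ssgn_def power_add[symmetric])

lemma ssgn_single: "i \<noteq> j \<Longrightarrow> ssgn {|i|} {|j|} * ssgn {|j|} {|i|} = - 1"
  using ssgn_swap[of i "{|j|}"] by (simp add: fcard_finsert_disjoint fcard_fempty)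

lemma ssgn_finsert: "i |\<notin>| S \<Longrightarrow> ssgn T (finsert i S) = ssgn T {|i|} * ssgn T S"
  using ssgn_union2[of "{|i|}" S T] by simp

lemma pdc_h:
  "i |\<notin>| fst m \<Longrightarrow> ssgn {|i|} (fst m) *\<^sub>R pdc j (finsert i (fst m), snd m) = h i * pdc j m"
  "i |\<in>| fst m \<Longrightarrow> h i * pdc j m = 0"
  by (auto simp: pdc_def h_mon)

lemma pdh_h:
  "i |\<notin>| fst m \<Longrightarrow> ssgn {|i|} (fst m) *\<^sub>R pdh j (finsert i (fst m), snd m) =
    (if i = j then mon m else 0) - h i * pdh j m"
  "i |\<in>| fst m \<Longrightarrow> (if i = j then mon m else 0) - h i * pdh j m = 0"
proof -
  assume i: "i |\<notin>| fst m"
  show "ssgn {|i|} (fst m) *\<^sub>R pdh j (finsert i (fst m), snd m) =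
    (if i = j then mon m else 0) - h i * pdh j m"
  proof (cases "i = j")
    case True
    then show ?thesis
      using i by (auto simp: pdh_def ssgn_finsert[of j "fst m"] ssgn_self ssgn_sq)
  next
    case ij: False
    show ?thesis
    proof (cases "j |\<in>| fst m")
      case True
      define S where "S = fst m |-| {|j|}"
      have S: "fst m = finsert j S" "j |\<notin>| S" "i |\<notin>| S" using True i by (auto simp: S_def)
      have 1: "finsert i (finsert j S) |-| {|j|} = finsert i S" "finsert j S |-| {|j|} = S"
        using S ij by auto
      have 2: "ssgn {|j|} (finsert j S) = ssgn {|j|} S"
        using S by (simp add: ssgn_finsert[of j S] ssgn_self)
      have 3: "ssgn {|i|} (finsert j S) * ssgn {|j|} (finsert i (finsert j S)) =
          - (ssgn {|j|} S * ssgn {|i|} S)"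
      proof -
        have "ssgn {|i|} (finsert j S) * ssgn {|j|} (finsert i (finsert j S)) =
            (ssgn {|i|} {|j|} * ssgn {|j|} {|i|}) * (ssgn {|i|} S * ssgn {|j|} S)"
          using S ij by (simp add: ssgn_finsert[of i "finsert j S"] ssgn_finsert[of j S] ssgn_self mult_ac)
        then show ?thesis by (simp add: ssgn_single[OF ij])
      qed
      have "pdh j (finsert i (fst m), snd m) =
          ssgn {|j|} (finsert i (finsert j S)) *\<^sub>R mon (finsert i S, snd m)"
        by (simp add: pdh_def S(1) 1)
      moreover have "h i * pdh j m = (ssgn {|j|} S * ssgn {|i|} S) *\<^sub>R mon (finsert i S, snd m)"
        using S(3) by (simp add: pdh_def S(1) 1 2 h_mon)
      ultimately show ?thesis using ij by (simp only: S(1) scaleR_scaleR 3) simp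
    next
      case False
      then show ?thesis using ij by (simp add: pdh_def)
    qed
  qed
next
  assume i: "i |\<in>| fst m"
  show "(if i = j then mon m else 0) - h i * pdh j m = 0"
  proof (cases "i = j")
    case True
    define S where "S = fst m |-| {|j|}"
    have S: "fst m = finsert j S" "j |\<notin>| S" using True i by (auto simp: S_def)
    have "finsert j S |-| {|j|} = S" using S by auto
    then show ?thesis using S True
      by (cases m) (auto simp: pdh_def h_mon ssgn_finsert[of j S] ssgn_self ssgn_sq)
  next
    case False
    then show ?thesis using i by (simp add: pdh_def h_mon)
  qed
qed

lemma deriv_h_mon:
  assumes "finite A" "fset (fst m) \<subseteq> A" "set_mset (snd m) \<subseteq> A" "i \<in> A"
  shows "deriv f g (h i * mon m) =
    (\<Sum>j\<in>A. f j * ((if i = j then mon m else 0) - h i * pdh j m) + g j * (h i * pdc j m))"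
proof (cases "i |\<in>| fst m")
  case True
  then show ?thesis
    by (simp add: h_mon pdh_h(2) pdc_h(2) linear_0[OF linear_deriv])
next
  case False
  have "deriv f g (h i * mon m) = ssgn {|i|} (fst m) *\<^sub>R deriv f g (mon (finsert i (fst m), snd m))"
    using False by (simp add: h_mon linear_scale[OF linear_deriv])
  also have "deriv f g (mon (finsert i (fst m), snd m)) = (\<Sum>j\<in>A. f j * pdh j (finsert i (fst m), snd m)
      + g j * pdc j (finsert i (fst m), snd m))"
    by (rule deriv_mon) (use assms in auto)
  also have "ssgn {|i|} (fst m) *\<^sub>R \<dots> = (\<Sum>j\<in>A. f j * (ssgn {|i|} (fst m) *\<^sub>R pdh j (finsert i (fst m), snd m))
      + g j * (ssgn {|i|} (fst m) *\<^sub>R pdc j (finsert i (fst m), snd m)))"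
    by (simp add: scaleR_sum_right scaleR_add_right)
  finally show ?thesis
    using False by (simp only: pdh_h(1)[OF False] pdc_h(1)[OF False])
qed

lemma deriv_h_unsigned:
  assumes f: "\<And>j. f j * h i = - (h i * f j)" and g: "\<And>j. g j * h i = h i * g j"
  shows "deriv f g (h i * x) = f i * x + h i * deriv f g x"
proof -
  have fg: "f j * (h i * x) = - (h i * (f j * x))" "g j * (h i * x) = h i * (g j * x)" for j x
    by (simp_all add: mult.assoc[symmetric] f g)
  show ?thesis
  proof (induction x rule: gca_induct)
    case (mon m)
    define A where "A = insert i (fset (fst m) \<union> set_mset (snd m))"
    have "deriv f g (h i * mon m) =
      (\<Sum>j\<in>A. f j * ((if i = j then mon m else 0) - h i * pdh j m) + g j * (h i * pdc j m))"
      by (rule deriv_h_mon) (auto simp: A_def)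
    also have "\<dots> = (\<Sum>j\<in>A. h i * (f j * pdh j m + g j * pdc j m)) + (\<Sum>j\<in>A. if i = j then f j * mon m else 0)"
      unfolding sum.distrib[symmetric]
      by (intro sum.cong refl) (auto simp: distrib_left right_diff_distrib fg)
    also have "(\<Sum>j\<in>A. if i = j then f j * mon m else 0) = f i * mon m"
      by (simp add: A_def)
    also have "(\<Sum>j\<in>A. h i * (f j * pdh j m + g j * pdc j m)) = h i * deriv f g (mon m)"
      by (subst deriv_mon[of A]) (auto simp: A_def sum_distrib_left)
    finally show ?case by simp
  qed (simp_all add: algebra_simps linear_add[OF linear_deriv] linear_scale[OF linear_deriv])
qed

lemma deriv_h_signed:
  assumes f: "\<And>j. f j * h i = h i * f j"
  shows "deriv f (\<lambda>_. 0) (h i * x) = f i * x - h i * deriv f (\<lambda>_. 0) x"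
proof -
  have fg: "f j * (h i * x) = h i * (f j * x)" for j x
    by (simp add: mult.assoc[symmetric] f)
  show ?thesis
  proof (induction x rule: gca_induct)
    case (mon m)
    define A where "A = insert i (fset (fst m) \<union> set_mset (snd m))"
    have "deriv f (\<lambda>_. 0) (h i * mon m) =
      (\<Sum>j\<in>A. f j * ((if i = j then mon m else 0) - h i * pdh j m) + 0 * (h i * pdc j m))"
      by (rule deriv_h_mon) (auto simp: A_def)
    also have "\<dots> = (\<Sum>j\<in>A. if i = j then f j * mon m else 0) - (\<Sum>j\<in>A. h i * (f j * pdh j m + 0 * pdc j m))"
      unfolding sum_subtractf[symmetric]
      by (intro sum.cong refl) (auto simp: distrib_left right_diff_distrib fg)
    also have "(\<Sum>j\<in>A. if i = j then f j * mon m else 0) = f i * mon m"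
      by (simp add: A_def)
    also have "(\<Sum>j\<in>A. h i * (f j * pdh j m + 0 * pdc j m)) = h i * deriv f (\<lambda>_. 0) (mon m)"
      by (subst deriv_mon[of A]) (auto simp: A_def sum_distrib_left)
    finally show ?case by simp
  qed (simp_all add: distrib_left linear_add[OF linear_deriv] linear_scale[OF linear_deriv] scaleR_diff_right)
qed

lemma h_anticomm: "h i * h j = - (h j * h i)"
  using h_comm[of i "h j"] by (simp add: h_def par_mon fcard_finsert_disjoint fcard_fempty)

lemma scaled_h_anticomm: "(r *\<^sub>R h j) * h i = - (h i * (r *\<^sub>R h j))"
proof -
  have "(r *\<^sub>R h j) * h i = r *\<^sub>R (- (h i * h j))"
    by (simp only: mult_scaleR_left h_anticomm[of j i])
  then show ?thesis by simp
qed

lemma scaled_c_central: "(r *\<^sub>R c j) * x = x * (r *\<^sub>R c j)"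
  by (simp add: c_central[of j x])

lemma gen_induct [case_names add scale one h c]:
  assumes add: "\<And>x y. P x \<Longrightarrow> P y \<Longrightarrow> P (x + y)" and scale: "\<And>r x. P x \<Longrightarrow> P (r *\<^sub>R x)"
    and one: "P 1" and h: "\<And>i x. P x \<Longrightarrow> P (h i * x)" and c: "\<And>i x. P x \<Longrightarrow> P (c i * x)"
  shows "P x"
proof (induction x rule: gca_induct)
  case (mon m)
  obtain S M where m: "m = (S, M)" by (cases m)
  have "P (mon ({||}, M))"
  proof (induction M)
    case empty
    then show ?case using one by (simp add: one_gca_def)
  next
    case (add i M)
    then show ?case using c[of "mon ({||}, M)" i] by (simp add: c_mon)
  qed
  then have "P (mon (S, M))"
  proof (induction S)
    case (insert i S)
    have "P (ssgn {|i|} S *\<^sub>R (h i * mon (S, M)))" by (intro scale h insert)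
    then show ?case using insert.hyps by (simp add: h_mon ssgn_sq)
  qed simp
  then show ?case by (simp add: m)
qed (erule (1) add, erule scale)

definition gd :: "gca \<Rightarrow> gca" where
  "gd = deriv c (\<lambda>_. 0)"

definition gdelta :: "gca \<Rightarrow> gca" where
  "gdelta = deriv (\<lambda>i. h (i + 1)) (\<lambda>i. c (i + 1))"

definition gsigma :: "gca \<Rightarrow> gca" where
  "gsigma = deriv (\<lambda>i. (real i * (real i - 1) / 2) *\<^sub>R h (i - 1))
                  (\<lambda>i. (real i * (real i - 1) / 2) *\<^sub>R c (i - 1))"

text \<open>Multiplication by the order; it is the commutator of \<open>gsigma\<close> and \<open>gdelta\<close>.\<close>

definition gord :: "gca \<Rightarrow> gca" where
  "gord = deriv (\<lambda>i. real i *\<^sub>R h i) (\<lambda>i. real i *\<^sub>R c i)"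

lemma gd_linear: "linear gd" and gdelta_linear: "linear gdelta"
  and gsigma_linear: "linear gsigma" and gord_linear: "linear gord"
  by (simp_all add: gd_def gdelta_def gsigma_def gord_def linear_deriv)

lemmas lin_simps =
  linear_add[OF gd_linear] linear_scale[OF gd_linear] linear_diff[OF gd_linear] linear_0[OF gd_linear]
  linear_add[OF gdelta_linear] linear_scale[OF gdelta_linear] linear_diff[OF gdelta_linear] linear_0[OF gdelta_linear]
  linear_add[OF gsigma_linear] linear_scale[OF gsigma_linear] linear_diff[OF gsigma_linear] linear_0[OF gsigma_linear]
  linear_add[OF gord_linear] linear_scale[OF gord_linear] linear_diff[OF gord_linear] linear_0[OF gord_linear]
  linear_add[OF linear_par] linear_scale[OF linear_par] linear_diff[OF linear_par] linear_0[OF linear_par]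

lemma gd_gen:
  "gd 1 = 0" "gd (h i * x) = c i * x - h i * gd x" "gd (c i * x) = c i * gd x"
  by (simp_all add: gd_def deriv_c) (rule deriv_h_signed, rule c_central)

lemma gdelta_gen:
  "gdelta 1 = 0" "gdelta (h i * x) = h (i + 1) * x + h i * gdelta x"
  "gdelta (c i * x) = c (i + 1) * x + c i * gdelta x"
  by (simp_all add: gdelta_def deriv_c) (rule deriv_h_unsigned, rule h_anticomm, rule c_central)

lemma gsigma_gen:
  "gsigma 1 = 0"
  "gsigma (h i * x) = (real i * (real i - 1) / 2) *\<^sub>R (h (i - 1) * x) + h i * gsigma x"
  "gsigma (c i * x) = (real i * (real i - 1) / 2) *\<^sub>R (c (i - 1) * x) + c i * gsigma x"
  unfolding gsigma_def
  by (simp, subst deriv_h_unsigned, rule scaled_h_anticomm, rule scaled_c_central,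
      simp, simp add: deriv_c)

lemma gord_gen:
  "gord 1 = 0" "gord (h i * x) = real i *\<^sub>R (h i * x) + h i * gord x"
  "gord (c i * x) = real i *\<^sub>R (c i * x) + c i * gord x"
  unfolding gord_def
  by (simp, subst deriv_h_unsigned, rule scaled_h_anticomm, rule scaled_c_central,
      simp, simp add: deriv_c)

lemma par_gen: "par 1 = 1" "par (h i * x) = - (h i * par x)" "par (c i * x) = c i * par x"
proof -
  show "par 1 = 1" by (simp add: one_gca_def par_mon fcard_fempty)
  show "par (h i * x) = - (h i * par x)"
    by (induction x rule: gca_induct)
      (auto simp: algebra_simps lin_simps h_mon par_mon fcard_finsert_disjoint)
  show "par (c i * x) = c i * par x"
    by (induction x rule: gca_induct) (auto simp: algebra_simps lin_simps c_mon par_mon)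
qed

lemma on_generators:
  "gd (h i) = c i" "gd (c i) = 0"
  "gdelta (h i) = h (i + 1)" "gdelta (c i) = c (i + 1)"
  "gsigma (h i) = (real i * (real i - 1) / 2) *\<^sub>R h (i - 1)"
  "gsigma (c i) = (real i * (real i - 1) / 2) *\<^sub>R c (i - 1)"
  using gd_gen(2)[of i 1] gd_gen(3)[of i 1] gdelta_gen(2)[of i 1] gdelta_gen(3)[of i 1]
    gsigma_gen(2)[of i 1] gsigma_gen(3)[of i 1]
  by (simp_all add: gd_gen(1) gdelta_gen(1) gsigma_gen(1))

lemma leibniz:
  "gd (x * y) = gd x * y + par x * gd y"
  "gdelta (x * y) = gdelta x * y + x * gdelta y"
  "gsigma (x * y) = gsigma x * y + x * gsigma y"
  "gord (x * y) = gord x * y + x * gord y"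
proof -
  show "gd (x * y) = gd x * y + par x * gd y"
    by (induction x rule: gen_induct) (simp_all add: gd_gen par_gen lin_simps algebra_simps)
  show "gdelta (x * y) = gdelta x * y + x * gdelta y"
    by (induction x rule: gen_induct) (simp_all add: gdelta_gen lin_simps algebra_simps)
  show "gsigma (x * y) = gsigma x * y + x * gsigma y"
    by (induction x rule: gen_induct) (simp_all add: gsigma_gen lin_simps algebra_simps)
  show "gord (x * y) = gord x * y + x * gord y"
    by (induction x rule: gen_induct) (simp_all add: gord_gen lin_simps algebra_simps)
qed

lemma gd_gd: "gd (gd x) = 0"
  by (induction x rule: gen_induct) (simp_all add: gd_gen lin_simps)

lemma gd_gdelta: "gd (gdelta x) = gdelta (gd x)"
  by (induction x rule: gen_induct) (simp_all add: gd_gen gdelta_gen lin_simps algebra_simps)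

lemma gd_gsigma: "gd (gsigma x) = gsigma (gd x)"
  by (induction x rule: gen_induct) (simp_all add: gd_gen gsigma_gen lin_simps algebra_simps)

lemma gord_gdelta: "gord (gdelta x) = gdelta (gord x) + gdelta x"
  by (induction x rule: gen_induct) (simp_all add: gord_gen gdelta_gen lin_simps algebra_simps)

lemma sigma_delta_coeff:
  "(real (i + 1) * (real (i + 1) - 1) / 2) *\<^sub>R (u i :: gca) =
   (real i * (real i - 1) / 2) *\<^sub>R u (i - 1 + 1) + real i *\<^sub>R u i"
proof -
  have "real (i + 1) * (real (i + 1) - 1) / 2 = real i * (real i - 1) / 2 + real i"
    by (simp add: field_simps)
  then show ?thesis by (cases i) (simp_all only: scaleR_add_left, simp_all)
qed

lemma gsigma_gdelta: "gsigma (gdelta x) = gdelta (gsigma x) + gord x"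
proof (induction x rule: gen_induct)
  case (h i x)
  show ?case
    using sigma_delta_coeff[of i "\<lambda>j. h j * x"]
    by (simp only: gsigma_gen gord_gen gdelta_gen lin_simps h distrib_left) (simp add: algebra_simps)
next
  case (c i x)
  show ?case
    using sigma_delta_coeff[of i "\<lambda>j. c j * x"]
    by (simp only: gsigma_gen gord_gen gdelta_gen lin_simps c distrib_left) (simp add: algebra_simps)
qed (simp_all add: gsigma_gen gord_gen gdelta_gen lin_simps scaleR_add_right)

section \<open>The ideal and the quotient algebra\<close>

text \<open>The two-sided ideal generated by the elements \<open>rel k\<close>.\<close>

definition rel :: "nat \<Rightarrow> gca" where
  "rel k = (gdelta ^^ k) (c 0 * c 0)"

definition II :: "gca set" where
  "II = span {x * rel k * y | x k y. True}"

lemma gd_rel: "gd (rel k) = 0"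
proof (induction k)
  case 0
  then show ?case by (simp add: rel_def gd_gen on_generators)
next
  case (Suc k)
  have "gd (rel (Suc k)) = gdelta (gd (rel k))" by (simp add: rel_def gd_gdelta)
  then show ?case by (simp add: Suc lin_simps)
qed

lemma gdelta_rel: "gdelta (rel k) = rel (Suc k)"
  by (simp add: rel_def)

lemma gord_rel: "gord (rel k) = real k *\<^sub>R rel k"
proof (induction k)
  case 0
  have "gord (c 0) = 0" using gord_gen(3)[of 0 1] by (simp add: gord_gen)
  then show ?case by (simp add: rel_def leibniz)
next
  case (Suc k)
  have "gord (rel (Suc k)) = gdelta (gord (rel k)) + gdelta (rel k)"
    by (simp add: gord_gdelta gdelta_rel[symmetric])
  then show ?case by (simp add: Suc lin_simps gdelta_rel scaleR_add_left)
qed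

lemma gsigma_rel: "gsigma (rel k) = (real k * (real k - 1) / 2) *\<^sub>R rel (k - 1)"
proof (induction k)
  case 0
  then show ?case by (simp add: rel_def leibniz on_generators)
next
  case (Suc k)
  have "gsigma (rel (Suc k)) = gdelta (gsigma (rel k)) + gord (rel k)"
    by (simp add: gsigma_gdelta gdelta_rel[symmetric])
  then show ?case
    using sigma_delta_coeff[of k rel]
    by (simp only: Suc gord_rel lin_simps gdelta_rel) simp
qed

lemma subspace_II: "subspace II" by (simp add: II_def)

lemma II_gen: "x * rel k * y \<in> II"
  unfolding II_def by (rule span_base) blast

lemma II_map:
  assumes "linear f" "\<And>x k y. f (x * rel k * y) \<in> II" "z \<in> II"
  shows "f z \<in> II"
  using assms(3) unfolding II_def
proof (induction rule: span_induct)
  case base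
  show ?case
    using assms(1) subspace_II unfolding subspace_def II_def[symmetric]
    by (auto simp: linear_0 linear_add linear_scale)
next
  case (step x)
  then show ?case using assms(2) by (auto simp: II_def)
qed

lemma II_mult_left: "z \<in> II \<Longrightarrow> a * z \<in> II"
proof (rule II_map[of "\<lambda>z. a * z"])
  show "linear (\<lambda>z. a * z)" by (rule linearI) (simp_all add: distrib_left)
  show "a * (x * rel k * y) \<in> II" for x k y
    using II_gen[of "a * x" k y] by (simp add: mult.assoc)
qed

lemma II_mult_right: "z \<in> II \<Longrightarrow> z * a \<in> II"
proof (rule II_map[of "\<lambda>z. z * a"])
  show "linear (\<lambda>z. z * a)" by (rule linearI) (simp_all add: distrib_right)
  show "x * rel k * y * a \<in> II" for x k y
    using II_gen[of x k "y * a"] by (simp add: mult.assoc)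
qed

lemma gd_II: "z \<in> II \<Longrightarrow> gd z \<in> II"
proof (erule II_map[OF gd_linear, rotated])
  fix x y k
  have "gd (x * rel k * y) = gd x * rel k * y + par (x * rel k) * gd y"
    by (simp add: leibniz gd_rel)
  moreover have "par (x * rel k) = par x * rel k"
  proof -
    have hom: "par (u * v) = par u * par v" for u v
      by (induction u rule: gen_induct) (simp_all add: par_gen lin_simps algebra_simps)
    have "par (gdelta u) = gdelta (par u)" for u
      by (induction u rule: gen_induct)
        (simp_all add: par_gen gdelta_gen lin_simps linear_neg[OF gdelta_linear] algebra_simps)
    then have "par (rel k) = (gdelta ^^ k) (par (c 0 * c 0))"
      unfolding rel_def by (induction k) simp_all
    also have "par (c 0 * c 0) = c 0 * c 0"
      using par_gen(3)[of 0 1] by (simp add: par_gen)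
    finally show ?thesis by (simp add: hom rel_def)
  qed
  ultimately show "gd (x * rel k * y) \<in> II"
    by (simp add: subspace_add[OF subspace_II] II_gen)
qed

lemma gdelta_II: "z \<in> II \<Longrightarrow> gdelta z \<in> II"
proof (erule II_map[OF gdelta_linear, rotated])
  fix x y k
  have "gdelta (x * rel k * y) = gdelta x * rel k * y + x * rel (Suc k) * y + x * rel k * gdelta y"
    by (simp add: leibniz gdelta_rel distrib_right)
  then show "gdelta (x * rel k * y) \<in> II"
    by (simp add: subspace_add[OF subspace_II] II_gen)
qed

lemma gsigma_II: "z \<in> II \<Longrightarrow> gsigma z \<in> II"
proof (erule II_map[OF gsigma_linear, rotated])
  fix x y k
  have "gsigma (x * rel k * y) = gsigma x * rel k * y
      + (real k * (real k - 1) / 2) *\<^sub>R (x * rel (k - 1) * y) + x * rel k * gsigma y"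
    by (simp add: leibniz gsigma_rel distrib_right)
  then show "gsigma (x * rel k * y) \<in> II"
    by (simp add: subspace_add[OF subspace_II] subspace_scale[OF subspace_II] II_gen)
qed

quotient_type dw = gca / "\<lambda>x y. x - y \<in> II"
proof (rule equivpI)
  show "reflp (\<lambda>x y. x - y \<in> II)"
    by (rule reflpI) (simp add: subspace_0[OF subspace_II])
  show "symp (\<lambda>x y. x - y \<in> II)"
    by (rule sympI) (metis minus_diff_eq subspace_neg[OF subspace_II])
  show "transp (\<lambda>x y. x - y \<in> II)"
    by (rule transpI) (metis diff_add_cancel add_diff_eq subspace_add[OF subspace_II])
qed

instantiation dw :: real_algebra
begin

lift_definition zero_dw :: dw is 0 .

lift_definition plus_dw :: "dw \<Rightarrow> dw \<Rightarrow> dw" is "(+)"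
  by (metis add_diff_add subspace_add[OF subspace_II])

lift_definition uminus_dw :: "dw \<Rightarrow> dw" is uminus
  by (metis minus_diff_eq minus_diff_minus subspace_neg[OF subspace_II])

lift_definition minus_dw :: "dw \<Rightarrow> dw \<Rightarrow> dw" is "(-)"
proof -
  fix x x' y y' :: gca
  assume "x - x' \<in> II" "y - y' \<in> II"
  then have "(x - x') - (y - y') \<in> II" by (rule subspace_diff[OF subspace_II])
  then show "(x - y) - (x' - y') \<in> II" by (simp add: algebra_simps)
qed

lift_definition scaleR_dw :: "real \<Rightarrow> dw \<Rightarrow> dw" is scaleR
  by (metis scaleR_diff_right subspace_scale[OF subspace_II])

lift_definition times_dw :: "dw \<Rightarrow> dw \<Rightarrow> dw" is "(*)"
proof -
  fix x x' y y' :: gca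
  assume "x - x' \<in> II" "y - y' \<in> II"
  then have "(x - x') * y + x' * (y - y') \<in> II"
    by (intro subspace_add[OF subspace_II] II_mult_left II_mult_right)
  then show "x * y - x' * y' \<in> II" by (simp add: algebra_simps)
qed

instance
  by standard (transfer; simp add: algebra_simps subspace_0[OF subspace_II])+

end

text \<open>The canonical projection onto the quotient algebra, and the maps induced on the quotient.\<close>

definition proj :: "gca \<Rightarrow> dw" where "proj = abs_dw"

lift_definition dd :: "dw \<Rightarrow> dw" is gd
  by (metis gd_II linear_diff[OF gd_linear])

lift_definition ddelta :: "dw \<Rightarrow> dw" is gdelta
  by (metis gdelta_II linear_diff[OF gdelta_linear])

lift_definition dsigma :: "dw \<Rightarrow> dw" is gsigma
  by (metis gsigma_II linear_diff[OF gsigma_linear])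

lemma linear_proj: "linear proj"
  by (rule linearI) (simp_all add: proj_def plus_dw.abs_eq scaleR_dw.abs_eq)

lemma proj_mult: "proj (x * y) = proj x * proj y"
  by (simp add: proj_def times_dw.abs_eq)

lemma proj_eq_iff: "proj x = proj y \<longleftrightarrow> x - y \<in> II"
  by (simp add: proj_def dw.abs_eq_iff)

lemma dd_proj: "dd (proj x) = proj (gd x)"
  and ddelta_proj: "ddelta (proj x) = proj (gdelta x)"
  and dsigma_proj: "dsigma (proj x) = proj (gsigma x)"
  by (simp_all add: proj_def dd.abs_eq ddelta.abs_eq dsigma.abs_eq)

lemma linear_dd: "linear dd"
  by (rule linearI; transfer; simp add: subspace_0[OF subspace_II] lin_simps)

lemma linear_ddelta: "linear ddelta"
  by (rule linearI; transfer; simp add: subspace_0[OF subspace_II] lin_simps)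

lemma linear_dsigma: "linear dsigma"
  by (rule linearI; transfer; simp add: subspace_0[OF subspace_II] lin_simps)

lemma dd_dd: "dd (dd x) = 0"
  by transfer (simp add: gd_gd subspace_0[OF subspace_II])

lemma dd_ddelta: "dd (ddelta x) = ddelta (dd x)"
  by transfer (simp add: gd_gdelta subspace_0[OF subspace_II])

lemma dd_dsigma: "dd (dsigma x) = dsigma (dd x)"
  by transfer (simp add: gd_gsigma subspace_0[OF subspace_II])

section \<open>Cohomology\<close>

lemma subspace_range_dd: "subspace (range dd)"
  by (rule linear_subspace_image[OF linear_dd subspace_UNIV])

text \<open>The total cohomology \<open>ker d / im d\<close>: \<open>coh_class x\<close> is the class of \<open>x\<close>, which is
  meaningful for cocycles \<open>x\<close> only.\<close>

quotient_type coh = dw / partial: "\<lambda>x y. dd x = 0 \<and> dd y = 0 \<and> x - y \<in> range dd"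
  morphisms rep_coh coh_class
proof (rule part_equivpI)
  note sub = subspace_range_dd
  show "\<exists>x. dd x = 0 \<and> dd x = 0 \<and> x - x \<in> range dd"
    by (rule exI[of _ 0]) (simp add: linear_0[OF linear_dd] subspace_0[OF sub])
  show "symp (\<lambda>x y. dd x = 0 \<and> dd y = 0 \<and> x - y \<in> range dd)"
    by (rule sympI) (metis minus_diff_eq subspace_neg[OF sub])
  show "transp (\<lambda>x y. dd x = 0 \<and> dd y = 0 \<and> x - y \<in> range dd)"
    by (rule transpI) (metis diff_add_cancel add_diff_eq subspace_add[OF sub])
qed

lemmas dd_lin = linear_add[OF linear_dd] linear_scale[OF linear_dd] linear_diff[OF linear_dd]
  linear_0[OF linear_dd] linear_neg[OF linear_dd]

instantiation coh :: real_vector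
begin

lift_definition zero_coh :: coh is 0
  by (simp add: dd_lin subspace_0[OF subspace_range_dd])

lift_definition plus_coh :: "coh \<Rightarrow> coh \<Rightarrow> coh" is "(+)"
  by (simp add: dd_lin add_diff_add subspace_add[OF subspace_range_dd])

lift_definition uminus_coh :: "coh \<Rightarrow> coh" is uminus
  by (metis dd_lin(5) add.inverse_neutral minus_diff_minus subspace_neg[OF subspace_range_dd])

lift_definition minus_coh :: "coh \<Rightarrow> coh \<Rightarrow> coh" is "(-)"
proof -
  fix x x' y y' :: dw
  assume *: "dd x = 0 \<and> dd x' = 0 \<and> x - x' \<in> range dd" "dd y = 0 \<and> dd y' = 0 \<and> y - y' \<in> range dd"
  then have "(x - x') - (y - y') \<in> range dd"
    by (blast intro: subspace_diff[OF subspace_range_dd])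
  then show "dd (x - y) = 0 \<and> dd (x' - y') = 0 \<and> x - y - (x' - y') \<in> range dd"
    using * by (simp add: dd_lin algebra_simps)
qed

lift_definition scaleR_coh :: "real \<Rightarrow> coh \<Rightarrow> coh" is scaleR
  by (simp add: dd_lin scaleR_diff_right[symmetric] subspace_scale[OF subspace_range_dd])

instance
  by standard (transfer; simp add: dd_lin algebra_simps subspace_0[OF subspace_range_dd])+

end

lift_definition hdelta :: "coh \<Rightarrow> coh" is ddelta
proof -
  fix x y :: dw
  assume *: "dd x = 0 \<and> dd y = 0 \<and> x - y \<in> range dd"
  then obtain z where "x - y = dd z" by auto
  then have "ddelta x - ddelta y = dd (ddelta z)"
    by (metis dd_ddelta linear_diff[OF linear_ddelta])
  then have "ddelta x - ddelta y \<in> range dd" by (metis rangeI)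
  then show "dd (ddelta x) = 0 \<and> dd (ddelta y) = 0 \<and> ddelta x - ddelta y \<in> range dd"
    using * by (simp add: dd_ddelta linear_0[OF linear_ddelta])
qed

lift_definition hsigma :: "coh \<Rightarrow> coh" is dsigma
proof -
  fix x y :: dw
  assume *: "dd x = 0 \<and> dd y = 0 \<and> x - y \<in> range dd"
  then obtain z where "x - y = dd z" by auto
  then have "dsigma x - dsigma y = dd (dsigma z)"
    by (metis dd_dsigma linear_diff[OF linear_dsigma])
  then have "dsigma x - dsigma y \<in> range dd" by (metis rangeI)
  then show "dd (dsigma x) = 0 \<and> dd (dsigma y) = 0 \<and> dsigma x - dsigma y \<in> range dd"
    using * by (simp add: dd_dsigma linear_0[OF linear_dsigma])
qed

lemma coh_class_eq_iff:
  "dd x = 0 \<Longrightarrow> dd y = 0 \<Longrightarrow> coh_class x = coh_class y \<longleftrightarrow> x - y \<in> range dd"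
  using Quotient3_rel[OF Quotient3_coh, of x y]
  by (auto simp: subspace_0[OF subspace_range_dd])

lemma hdelta_class: "dd x = 0 \<Longrightarrow> hdelta (coh_class x) = coh_class (ddelta x)"
  and hsigma_class: "dd x = 0 \<Longrightarrow> hsigma (coh_class x) = coh_class (dsigma x)"
  by (simp_all add: hdelta.abs_eq hsigma.abs_eq eq_onp_same_args subspace_0[OF subspace_range_dd])

text \<open>The index lists may be unordered; a monomial with a repeated factor \<open>h i\<close> vanishes.\<close>

definition monomial :: "nat list \<Rightarrow> nat list \<Rightarrow> dw" where
  "monomial is js = proj (prod_list (map h is) * prod_list (map c js))"

definition ord_part :: "nat \<Rightarrow> dw set" where
  "ord_part n = span {monomial is js | is js. sum_list is + sum_list js = n}"

definition type_part :: "nat \<Rightarrow> nat \<Rightarrow> dw set" where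
  "type_part a b = span {monomial is js | is js. length is = a \<and> length js = b}"

definition coh_ord :: "nat \<Rightarrow> coh set" where
  "coh_ord n = {coh_class x | x. dd x = 0 \<and> x \<in> ord_part n}"

definition coh_type :: "nat \<Rightarrow> nat \<Rightarrow> coh set" where
  "coh_type a b = {coh_class x | x. dd x = 0 \<and> x \<in> type_part a b}"

text \<open>The eigenspace of \<open>\<delta> \<circ> \<sigma>\<close> for the eigenvalue \<open>r\<close> on the order-\<open>n\<close> part.\<close>

definition eigen_part :: "real \<Rightarrow> nat \<Rightarrow> coh set" where
  "eigen_part r n = {u \<in> coh_ord n. (hdelta \<circ> hsigma) u = r *\<^sub>R u}"

end

theory Submission
  imports Defs
begin

text \<open>The complex is graded by the order and by the numbers of factors \<open>h\<close> and \<open>c\<close>, so a class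
  of order 5 and type \<open>(2, 2)\<close> has a representative with both properties. Modulo the relations,
  this part of the quotient algebra has the basis
  \<open>h\<^sub>1h\<^sub>2c\<^sub>0c\<^sub>2, h\<^sub>0h\<^sub>3c\<^sub>0c\<^sub>2, h\<^sub>0h\<^sub>2c\<^sub>1c\<^sub>2, h\<^sub>0h\<^sub>1c\<^sub>1c\<^sub>3, h\<^sub>0h\<^sub>1c\<^sub>0c\<^sub>4\<close>.
  The coboundaries of \<open>h\<^sub>0h\<^sub>1h\<^sub>2c\<^sub>2, h\<^sub>0h\<^sub>1h\<^sub>3c\<^sub>1, h\<^sub>0h\<^sub>1h\<^sub>4c\<^sub>0, h\<^sub>0h\<^sub>2h\<^sub>3c\<^sub>0\<close> reduce everything to multiples
  of \<open>h\<^sub>1h\<^sub>2c\<^sub>0c\<^sub>2\<close>, which is not a coboundary because an explicit linear functional that kills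
  the relations and the coboundaries is nonzero on it. Finally \<open>\<sigma>\<close> maps \<open>h\<^sub>1h\<^sub>2c\<^sub>0c\<^sub>2\<close> to
  \<open>h\<^sub>1h\<^sub>2c\<^sub>0c\<^sub>1\<close>, which vanishes since \<open>2c\<^sub>0c\<^sub>1\<close> is a relation.\<close>

section \<open>Projections onto graded pieces of the free algebra\<close>

text \<open>The arguments of \<open>A\<close> are the order, the number of \<open>h\<close>'s and the number of \<open>c\<close>'s. They are
  integers so that the index shifts below need no case distinction.\<close>

definition gpart :: "(int \<Rightarrow> int \<Rightarrow> int \<Rightarrow> bool) \<Rightarrow> gca \<Rightarrow> gca" where
  "gpart A = lin (\<lambda>m. if A (int (\<Sum>i\<in>fset (fst m). i) + int (\<Sum>\<^sub># (snd m)))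
      (int (fcard (fst m))) (int (size (snd m))) then mon m else 0)"

lemma linear_gpart: "linear (gpart A)"
  by (simp add: gpart_def linear_lin)

lemmas gpart_simps = linear_add[OF linear_gpart] linear_scale[OF linear_gpart]
  linear_diff[OF linear_gpart] linear_0[OF linear_gpart]

lemma gpart_mon:
  "gpart A (mon (S, M)) =
    (if A (int (\<Sum>i\<in>fset S. i) + int (\<Sum>\<^sub># M)) (int (fcard S)) (int (size M)) then mon (S, M) else 0)"
  by (simp add: gpart_def)

lemma gpart_one: "gpart A 1 = (if A 0 0 0 then 1 else 0)"
  by (simp add: one_gca_def gpart_mon fcard_fempty)

lemma gpart_c: "gpart A (c i * x) = c i * gpart (\<lambda>n a b. A (n + int i) a (b + 1)) x"
proof (induction x rule: gca_induct)
  case (mon m)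
  then show ?case by (cases m) (simp add: c_mon gpart_mon algebra_simps)
qed (simp_all add: algebra_simps gpart_simps)

lemma gpart_h: "gpart A (h i * x) = h i * gpart (\<lambda>n a b. A (n + int i) (a + 1) b) x"
proof (induction x rule: gca_induct)
  case (mon m)
  then show ?case
    by (cases m) (simp add: h_mon gpart_mon gpart_simps fcard_finsert_disjoint algebra_simps)
qed (simp_all add: algebra_simps gpart_simps)

text \<open>\<open>gd\<close> trades one factor \<open>h\<close> for a factor \<open>c\<close> of
  the same index. Passing a generator shifts the predicate, so the induction needs \<open>A\<close>
  arbitrary.\<close>

lemma gpart_gd: "gpart A (gd x) = gd (gpart (\<lambda>n a b. A n (a - 1) (b + 1)) x)"
proof (induction x arbitrary: A rule: gen_induct)
qed (simp_all add: gd_gen gpart_c gpart_h gpart_one lin_simps gpart_simps)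

lemma gpart_gdelta: "gpart A (gdelta x) = gdelta (gpart (\<lambda>n. A (n + 1)) x)"
proof (induction x arbitrary: A rule: gen_induct)
qed (simp_all add: gdelta_gen gpart_c gpart_h gpart_one lin_simps gpart_simps algebra_simps)

text \<open>\<open>rel k\<close> is homogeneous: order \<open>k\<close>, two factors
  \<open>c\<close>. The Leibniz rule expresses multiplication by \<open>rel (Suc k)\<close> through
  \<open>rel k\<close> and \<open>gdelta\<close>, so no closed form is needed.\<close>

lemma gpart_rel: "gpart A (rel k * x) = rel k * gpart (\<lambda>n a b. A (n + int k) a (b + 2)) x"
proof (induction k arbitrary: A x)
  case 0
  then show ?case by (simp add: rel_def gpart_c mult.assoc add.commute)
next
  case (Suc k)
  have step: "rel (Suc k) * y = gdelta (rel k * y) - rel k * gdelta y" for y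
    by (simp add: leibniz gdelta_rel)
  show ?case
    by (simp add: step gpart_simps gpart_gdelta Suc algebra_simps)
qed

section \<open>The ideal and its first generators\<close>

lemma rel_central: "rel k * x = x * rel k"
proof (induction k arbitrary: x)
  case 0
  then show ?case by (simp add: rel_def) (metis c_central mult.assoc)
next
  case (Suc k)
  have "gdelta (rel k * x) = gdelta (x * rel k)" by (simp add: Suc)
  then show ?case using Suc[of "gdelta x"] by (simp add: leibniz gdelta_rel)
qed

lemma II_rel: "rel k * x \<in> II"
  using II_gen[of 1 k x] by simp

text \<open>Centrality of the relations moves both cofactors to one side, so one-sided multiples
  suffice as test elements.\<close>

lemma II_map_rel:
  assumes "linear f" "\<And>k x. f (rel k * x) \<in> U" "subspace U" "z \<in> II"
  shows "f z \<in> U"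
proof -
  have "f (x * rel k * y) \<in> U" for x k y
    using assms(2)[of k "x * y"] by (simp add: rel_central mult.assoc)
  then have "II \<subseteq> f -` U"
    unfolding II_def using linear_subspace_vimage[OF assms(1,3)] by (intro span_minimal) auto
  with assms(4) show ?thesis by auto
qed

text \<open>The ideal is graded because its generators are homogeneous; hence the projections pass
  to congruences modulo \<open>II\<close>.\<close>

lemma gpart_II: "z \<in> II \<Longrightarrow> gpart A z \<in> II"
  by (rule II_map_rel[OF linear_gpart]) (simp_all add: gpart_rel II_rel subspace_II)

lemma rel_numeral:
  "rel 0 = c 0 * c 0"
  "rel 1 = 2 *\<^sub>R (c 0 * c 1)"
  "rel 2 = 2 *\<^sub>R (c 0 * c 2 + c 1 * c 1)"
  "rel 3 = 2 *\<^sub>R (c 0 * c 3 + 3 *\<^sub>R (c 1 * c 2))"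
  "rel 4 = 2 *\<^sub>R (c 0 * c 4 + 4 *\<^sub>R (c 1 * c 3) + 3 *\<^sub>R (c 2 * c 2))"
proof -
  show 0: "rel 0 = c 0 * c 0" by (simp add: rel_def)
  have "gdelta (rel 0) = 2 *\<^sub>R (c 0 * c 1)"
    by (simp add: 0 leibniz on_generators c_central[of "Suc 0" "c 0"] scaleR_2)
  then show 1: "rel 1 = 2 *\<^sub>R (c 0 * c 1)" by (simp add: gdelta_rel)
  have "gdelta (rel 1) = 2 *\<^sub>R (c 0 * c 2 + c 1 * c 1)"
    unfolding 1 by (simp add: lin_simps leibniz on_generators numeral_2_eq_2 add.commute)
  then show 2: "rel 2 = 2 *\<^sub>R (c 0 * c 2 + c 1 * c 1)"
    by (simp add: gdelta_rel numeral_2_eq_2)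
  have "gdelta (rel 2) = 2 *\<^sub>R (c 0 * c 3 + 3 *\<^sub>R (c 1 * c 2))"
    unfolding 2 by (simp add: lin_simps leibniz on_generators c_central[of "Suc (Suc 0)" "c (Suc 0)"]
      scaleR_left_distrib[of 1 2, simplified] scaleR_2 numeral_3_eq_3 numeral_2_eq_2 add_ac)
  then show 3: "rel 3 = 2 *\<^sub>R (c 0 * c 3 + 3 *\<^sub>R (c 1 * c 2))"
    by (simp add: gdelta_rel numeral_3_eq_3 numeral_2_eq_2)
  have "gdelta (rel 3) = 2 *\<^sub>R (c 0 * c 4 + 4 *\<^sub>R (c 1 * c 3) + 3 *\<^sub>R (c 2 * c 2))"
    unfolding 3 by (simp add: lin_simps leibniz on_generators c_central[of 3 "c 1"]
      scaleR_left_distrib[of 1 3, simplified] scaleR_add_right add_ac eval_nat_numeral)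
  then show "rel 4 = 2 *\<^sub>R (c 0 * c 4 + 4 *\<^sub>R (c 1 * c 3) + 3 *\<^sub>R (c 2 * c 2))"
    by (simp add: gdelta_rel)
qed

section \<open>The functional that detects the generator\<close>

lemma h_mon_less: "\<forall>j\<in>fset S. i < j \<Longrightarrow> h i * mon (S, M) = mon (finsert i S, M)"
proof -
  assume *: "\<forall>j\<in>fset S. i < j"
  then have "{(s, t). s |\<in>| {|i|} \<and> t |\<in>| S \<and> t < s} = {}" by fastforce
  then have "ssgn {|i|} S = 1" by (simp only: ssgn_def) simp
  then show ?thesis using * by (auto simp: h_mon)
qed

text \<open>Splitting off the least index unfolds a basis monomial into an increasing product of
  factors \<open>h\<close>, where \<open>h_mon_less\<close> produces no sign.\<close>

lemma fcard_Suc_min: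
  assumes "fcard (S :: nat fset) = Suc n"
  obtains i T where "S = finsert i T" "\<forall>j\<in>fset T. i < j" "fcard T = n"
proof
  define i where "i = Min (fset S)"
  have ne: "fset S \<noteq> {}" using assms by (auto simp: fcard.rep_eq)
  then have i: "i |\<in>| S" unfolding i_def by (simp add: Min_in)
  then show "S = finsert i (S |-| {|i|})" by auto
  show "\<forall>j\<in>fset (S |-| {|i|}). i < j"
    unfolding i_def by (auto simp: less_le)
  show "fcard (S |-| {|i|}) = n" using assms i by (simp add: fcard.rep_eq)
qed

lemma coeff_gpart:
  "coeff (gpart A x) (S, M) =
    (if A (int (\<Sum>i\<in>fset S. i) + int (\<Sum>\<^sub># M)) (int (fcard S)) (int (size M))
     then coeff x (S, M) else 0)"
proof (induction x rule: gca_induct)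
  case (mon m)
  show ?case
    by (cases m) (auto simp: gpart_mon mon.rep_eq zero_gca.rep_eq)
qed (simp_all add: gpart_simps plus_gca.rep_eq scaleR_gca.rep_eq)

text \<open>The coefficients solve the linear system saying that \<open>lam\<close> vanishes on the relations and on
  the four coboundaries; the coefficient of \<open>h\<^sub>0h\<^sub>1c\<^sub>0c\<^sub>4\<close> is 0.\<close>

definition lam :: "gca \<Rightarrow> real" where
  "lam x =
     3 * coeff x ({|0, 1|}, {#1, 3#}) - 4 * coeff x ({|0, 1|}, {#2, 2#})
   - 3 * coeff x ({|0, 2|}, {#0, 3#}) + coeff x ({|0, 2|}, {#1, 2#})
   - 3 * coeff x ({|0, 3|}, {#0, 2#}) + 3 * coeff x ({|0, 3|}, {#1, 1#})
   + 5 * coeff x ({|1, 2|}, {#0, 2#}) - 5 * coeff x ({|1, 2|}, {#1, 1#})"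

lemma linear_lam: "linear lam"
  by (rule linearI) (simp_all add: lam_def plus_gca.rep_eq scaleR_gca.rep_eq algebra_simps)

lemmas lam_simps = linear_add[OF linear_lam] linear_scale[OF linear_lam]
  linear_diff[OF linear_lam] linear_0[OF linear_lam] linear_neg[OF linear_lam]

text \<open>\<open>lam\<close> reads only coefficients of order 5 and type (2,2). Inserting the
  projection reduces the two vanishing statements below to finitely many monomials.\<close>

lemma lam_gpart:
  assumes "A 5 2 2"
  shows "lam (gpart A x) = lam x"
  by (simp add: lam_def coeff_gpart fcard_finsert_disjoint fcard_fempty assms)

lemma mon_hh: "i < j \<Longrightarrow> h i * (h j * mon ({||}, M)) = mon ({|i, j|}, M)"
  by (simp add: h_mon_less)

lemma mset_doubleton_eq_iff:
  "{#a, b#} = {#p, q#} \<longleftrightarrow> a = p \<and> b = q \<or> a = q \<and> b = p"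
  by (auto simp: add_eq_conv_ex)

lemmas lam_mon = lam_def mon.rep_eq fdoubleton_eq_iff mset_doubleton_eq_iff

lemma lam_hhcc:
  "i < j \<Longrightarrow> lam (h i * (h j * (c k * c l))) = lam (mon ({|i, j|}, {#k, l#}))"
  by (simp add: c_def[of l] c_mon mon_hh)

lemma c_h_commute: "c i * (h j * x) = h j * (c i * x)"
  by (rule c_left_commute[symmetric])

lemma c_comm: "c i * c j = c j * c i" "c i * (c j * x) = c j * (c i * x)"
  by (rule c_central) (rule c_left_commute)

lemma lam_gd: "lam (gd x) = 0"
proof -
  \<comment> \<open>The piece that \<open>gd\<close> carries into order 5 and type (2,2).\<close>
  define B :: "int \<Rightarrow> int \<Rightarrow> int \<Rightarrow> bool" where "B n a b \<longleftrightarrow> n = 5 \<and> a = 3 \<and> b = 1" for n a b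
  have "lam (gd (gpart B y)) = 0" for y
  proof (induction y rule: gca_induct)
    case (mon m)
    obtain S M where m: "m = (S, M)" by (cases m)
    show ?case
    proof (cases "int (\<Sum>i\<in>fset S. i) + int (\<Sum>\<^sub># M) = 5 \<and> fcard S = 3 \<and> size M = 1")
      case True
      then obtain l where M: "M = {#l#}" by (metis One_nat_def size_1_singleton_mset)
      have "fcard S = Suc 2" using True by simp
      then obtain i T where T: "S = finsert i T" "\<forall>j\<in>fset T. i < j" "fcard T = 2"
        by (rule fcard_Suc_min)
      have "fcard T = Suc 1" using T(3) by simp
      then obtain j U where U: "T = finsert j U" "\<forall>k\<in>fset U. j < k" "fcard U = 1"
        by (rule fcard_Suc_min)
      obtain k where k: "U = {|k|}"
        using U(3) by (auto elim: fcard_Suc_min[of U 0] simp: fcard_0_eq)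
      have less: "i < j" "j < k" "i < k" using T(2) U(1,2) by (auto simp: k)
      have "i + j + k + l = 5" using True less by (simp add: M T(1) U(1) k)
      then have "(i, j, k, l) \<in> {(0,1,2,2), (0,1,3,1), (0,1,4,0), (0,2,3,0)}"
        using less by simp presburger
      moreover have "gpart B (mon m) = h i * (h j * (h k * c l))"
        using True less by (simp add: m gpart_mon B_def T(1) U(1) k M c_def h_mon_less)
      ultimately show ?thesis
        by (auto simp: gd_gen on_generators algebra_simps c_h_commute lam_simps lam_hhcc)
          (simp_all add: lam_mon)
    next
      case False
      then show ?thesis by (auto simp: m gpart_mon B_def lin_simps lam_simps)
    qed
  qed (simp_all add: gpart_simps lin_simps lam_simps)
  then have "lam (gd (gpart (\<lambda>n a b. n = 5 \<and> a - 1 = 2 \<and> b + 1 = 2) x)) = 0"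
    by (simp add: B_def[abs_def] algebra_simps)
  then show ?thesis
    using lam_gpart[of "\<lambda>n a b. n = 5 \<and> a = 2 \<and> b = 2" "gd x"] by (simp add: gpart_gd)
qed

lemma lam_II:
  assumes "z \<in> II"
  shows "lam z = 0"
proof -
  \<comment> \<open>The predicate is the shift that \<open>gpart_rel\<close> makes of order 5, type
    (2,2): the cofactor of \<open>rel k\<close> has two factors \<open>h\<close> and no
    \<open>c\<close>.\<close>
  have *: "lam (rel k * gpart (\<lambda>n a b. n + int k = 5 \<and> a = 2 \<and> b + 2 = 2) y) = 0" for k y
  proof (induction y rule: gca_induct)
    case (mon m)
    obtain S M where m: "m = (S, M)" by (cases m)
    show ?case
    proof (cases "int (\<Sum>i\<in>fset S. i) + int (\<Sum>\<^sub># M) + int k = 5 \<and> fcard S = 2 \<and> size M = 0")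
      case True
      have "fcard S = Suc 1" using True by simp
      then obtain i T where T: "S = finsert i T" "\<forall>j\<in>fset T. i < j" "fcard T = 1"
        by (rule fcard_Suc_min)
      obtain j where j: "T = {|j|}"
        using T(3) by (auto elim: fcard_Suc_min[of T 0] simp: fcard_0_eq)
      have less: "i < j" using T(2) by (auto simp: j)
      have "i + j + k = 5" using True less by (auto simp add: T(1) j)
      \<comment> \<open>Since \<open>i < j\<close> makes \<open>i + j\<close> positive,
        \<open>k\<close> is at most 4, the range of \<open>rel_numeral\<close>.\<close>
      then have "(i, j, k) \<in> {(0,1,4), (0,2,3), (0,3,2), (1,2,2), (0,4,1), (1,3,1),
          (0,5,0), (1,4,0), (2,3,0)}"
        using less by simp presburger
      then show ?thesis
        using True
        by (auto simp: m gpart_mon T(1) j rel_numeral rel_numeral(2)[simplified] algebra_simps c_mon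
            lam_simps mult.assoc)
          (simp_all add: lam_mon)
    next
      case False
      then show ?thesis by (auto simp: m gpart_mon lam_simps)
    qed
  qed (simp_all add: gpart_simps lam_simps algebra_simps)
  have "lam (rel k * x) = 0" for k x
    using lam_gpart[of "\<lambda>n a b. n = 5 \<and> a = 2 \<and> b = 2" "rel k * x"] *[of k x]
    by (simp add: gpart_rel)
  then have "lam z \<in> {0}"
    by (intro II_map_rel[OF linear_lam _ _ assms]) (auto simp: subspace_def)
  then show ?thesis by simp
qed

section \<open>Reduction of order 5, type (2,2) to the generator\<close>

lemma h_square: "h i * (h i * x) = 0"
proof -
  have "h i * h i = 0" using h_anticomm[of i i] by (simp add: eq_neg_iff_add_eq_0 scaleR_2[symmetric])
  then show ?thesis by (simp add: mult.assoc[symmetric])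
qed

lemma subspace_scale_cancel: "subspace W \<Longrightarrow> r *\<^sub>R x \<in> W \<Longrightarrow> r \<noteq> 0 \<Longrightarrow> x \<in> W"
  using subspace_scale[of W "r *\<^sub>R x" "inverse r"] by simp

text \<open>Relations and coboundaries form a linear system in the monomials; it is solved modulo an
  arbitrary subspace \<open>W\<close> containing them and the generator.\<close>

lemma order5_type22:
  assumes W: "subspace W" "II \<subseteq> W" "range gd \<subseteq> W" and gen: "h 1 * (h 2 * (c 0 * c 2)) \<in> W"
    and sum: "i + j + k + l = 5"
  shows "h i * (h j * (c k * c l)) \<in> W"
proof -
  define m where "m i j k l = h i * (h j * (c k * c l))" for i j k l
  have rels: "h i * (h j * rel k) \<in> W" for i j k
    using W(2) II_gen[of "h i * h j" k 1] by (auto simp: mult.assoc)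
  have r0: "m i j 0 0 \<in> W" for i j
    using rels[of i j 0] by (simp add: rel_numeral m_def)
  have r1: "m i j 0 1 \<in> W" for i j
    using rels[of i j 1] unfolding rel_numeral m_def
    by (auto intro: subspace_scale_cancel[OF W(1)])
  have r2: "m i j 0 2 + m i j 1 1 \<in> W" for i j
    using rels[of i j 2] unfolding rel_numeral m_def
    by (auto simp: distrib_left[symmetric] intro: subspace_scale_cancel[OF W(1)])
  have r3: "m i j 0 3 + 3 *\<^sub>R m i j 1 2 \<in> W" for i j
    using rels[of i j 3] subspace_scale_cancel[OF W(1), of 2 "m i j 0 3 + 3 *\<^sub>R m i j 1 2"]
    by (simp add: rel_numeral m_def algebra_simps)
  have r4: "m i j 0 4 + 4 *\<^sub>R m i j 1 3 + 3 *\<^sub>R m i j 2 2 \<in> W" for i j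
    using rels[of i j 4]
      subspace_scale_cancel[OF W(1), of 2 "m i j 0 4 + 4 *\<^sub>R m i j 1 3 + 3 *\<^sub>R m i j 2 2"]
    by (simp add: rel_numeral m_def algebra_simps)
  have gds: "gd x \<in> W" for x using W(3) by auto
  have 1: "m 1 2 0 2 - m 0 2 1 2 + m 0 1 2 2 \<in> W"
    using gds[of "h 0 * (h 1 * (h 2 * c 2))"]
    by (simp add: gd_gen on_generators m_def algebra_simps c_h_commute)
  have 2: "m 1 3 0 1 - m 0 3 1 1 + m 0 1 1 3 \<in> W"
    using gds[of "h 0 * (h 1 * (h 3 * c 1))"]
    by (simp add: gd_gen on_generators m_def algebra_simps c_h_commute c_comm)
  have 3: "m 1 4 0 0 - m 0 4 0 1 + m 0 1 0 4 \<in> W"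
    using gds[of "h 0 * (h 1 * (h 4 * c 0))"]
    by (simp add: gd_gen on_generators m_def algebra_simps c_h_commute c_comm)
  have 4: "m 2 3 0 0 - m 0 3 0 2 + m 0 2 0 3 \<in> W"
    using gds[of "h 0 * (h 2 * (h 3 * c 0))"]
    by (simp add: gd_gen on_generators m_def algebra_simps c_h_commute c_comm)
  note add = subspace_add[OF W(1)] and diff = subspace_diff[OF W(1)]
    and scale = subspace_scale[OF W(1)]
  have m0104: "m 0 1 0 4 \<in> W"
    using diff[OF add[OF 3 r1[of 0 4]] r0[of 1 4]] by simp
  have 5: "4 *\<^sub>R m 0 1 1 3 + 3 *\<^sub>R m 0 1 2 2 \<in> W"
    using diff[OF r4[of 0 1] m0104] by simp
  have 6: "m 0 1 1 3 + m 0 3 0 2 \<in> W"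
    using diff[OF add[OF 2 r2[of 0 3]] r1[of 1 3]] by (simp add: algebra_simps)
  have 7: "m 0 3 0 2 + 3 *\<^sub>R m 0 2 1 2 \<in> W"
    using diff[OF r3[of 0 2] diff[OF 4 r0[of 2 3]]] by (simp add: algebra_simps)
  have m1202: "m 1 2 0 2 \<in> W" using gen by (simp add: m_def)
  have "3 *\<^sub>R m 0 2 1 2 + 4 *\<^sub>R m 0 1 1 3 \<in> W"
    using diff[OF scale[OF m1202, of 3] diff[OF scale[OF 1, of 3] 5]] by (simp add: algebra_simps)
  \<comment> \<open>Subtracting \<open>7\<close> cancels \<open>m 0 2 1 2\<close> and adding
    \<open>6\<close> cancels \<open>m 0 3 0 2\<close>. A nonzero multiple of one unknown remains,
    and back substitution yields the others.\<close>
  from add[OF diff[OF this 7] 6] have "4 *\<^sub>R m 0 1 1 3 + m 0 1 1 3 \<in> W"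
    by (simp add: algebra_simps)
  then have "5 *\<^sub>R m 0 1 1 3 \<in> W"
    using scaleR_left_distrib[of 4 1 "m 0 1 1 3"] by simp
  then have m0113: "m 0 1 1 3 \<in> W" by (rule subspace_scale_cancel[OF W(1)]) simp
  then have m0302: "m 0 3 0 2 \<in> W" using diff[OF 6 m0113] by simp
  then have "3 *\<^sub>R m 0 2 1 2 \<in> W" using diff[OF 7 m0302] by simp
  then have m0212: "m 0 2 1 2 \<in> W" by (rule subspace_scale_cancel[OF W(1)]) simp
  have "3 *\<^sub>R m 0 1 2 2 \<in> W" using diff[OF 5 scale[OF m0113, of 4]] by simp
  then have m0122: "m 0 1 2 2 \<in> W" by (rule subspace_scale_cancel[OF W(1)]) simp
  have m0203: "m 0 2 0 3 \<in> W" using diff[OF r3[of 0 2] scale[OF m0212, of 3]] by simp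
  have m0311: "m 0 3 1 1 \<in> W" using diff[OF r2[of 0 3] m0302] by simp
  have m1211: "m 1 2 1 1 \<in> W" using diff[OF r2[of 1 2] m1202] by simp
  have *: "m i j k l \<in> W" if "i < j" "k \<le> l" "i + j + k + l = 5" for i j k l
  proof -
    \<comment> \<open>All index choices with sorted factors; the last five contain
      \<open>c 0 * c 1\<close> or \<open>c 0 * c 0\<close> and are covered by \<open>r1\<close> and
      \<open>r0\<close>.\<close>
    have "(i, j, k, l) \<in> {(0,1,0,4), (0,1,1,3), (0,1,2,2), (0,2,0,3), (0,2,1,2), (0,3,0,2),
        (0,3,1,1), (1,2,0,2), (1,2,1,1), (0,4,0,1), (1,3,0,1), (0,5,0,0), (1,4,0,0), (2,3,0,0)}"
      using that by simp presburger
    then show ?thesis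
      using r0 r1 m0104 m0113 m0122 m0203 m0212 m0302 m0311 m1202 m1211 by auto
  qed
  have **: "m i j k l \<in> W" if "i < j" "i + j + k + l = 5" for i j k l
    using *[of i j k l] *[of i j l k] that c_central[of k "c l"] by (cases "k \<le> l") (auto simp: m_def)
  show ?thesis
  proof (cases i j rule: linorder_cases)
    case less
    then show ?thesis using **[of i j k l] sum by (simp add: m_def)
  next
    case equal
    then show ?thesis by (simp add: h_square subspace_0[OF W(1)])
  next
    case greater
    have "h i * (h j * (c k * c l)) = - m j i k l"
      by (simp add: m_def mult.assoc[symmetric] h_anticomm[of i j])
    then show ?thesis using **[of j i k l] greater sum subspace_neg[OF W(1)] by simp
  qed
qed

section \<open>The generator: cocycle, killed by sigma, not exact\<close>

lemma gd_generator: "gd (h 1 * (h 2 * (c 0 * c 2))) \<in> II"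
proof -
  \<comment> \<open>The term from \<open>h 1\<close> is a multiple of \<open>rel 1\<close>. In the
    term from \<open>h 2\<close>, \<open>c 2 * rel 2\<close> leaves \<open>c 1 * c 1 * c 2\<close>,
    which \<open>c 1 * rel 3\<close> turns into a multiple of \<open>c 0 * c 1 * c 3\<close>, hence
    of \<open>rel 1\<close>.\<close>
  have "gd (h 1 * (h 2 * (c 0 * c 2))) =
      (1 / 2) *\<^sub>R (h 2 * c 2 * rel 1) - (1 / 2) *\<^sub>R (h 1 * c 2 * rel 2)
      + (1 / 6) *\<^sub>R (h 1 * c 1 * rel 3) - (1 / 6) *\<^sub>R (h 1 * c 3 * rel 1)"
    unfolding rel_numeral
    by (simp add: gd_gen on_generators c_h_commute mult.assoc c_comm algebra_simps)
  moreover have "x * rel k \<in> II" for x k using II_gen[of x k 1] by simp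
  ultimately show ?thesis
    by (simp add: subspace_add subspace_diff subspace_scale subspace_II)
qed

lemma gsigma_generator: "gsigma (h 1 * (h 2 * (c 0 * c 2))) \<in> II"
proof -
  \<comment> \<open>Indices 0 and 1 have coefficient zero, and the term from \<open>h 2\<close>
    contains \<open>h 1\<close> twice; only the term from \<open>c 2\<close> survives.\<close>
  have "gsigma (h 1 * (h 2 * (c 0 * c 2))) = (1 / 2) *\<^sub>R (h 1 * h 2 * rel 1)"
    unfolding rel_numeral
    by (simp add: gsigma_gen on_generators mult.assoc h_square distrib_left)
  moreover have "x * rel k \<in> II" for x k using II_gen[of x k 1] by simp
  ultimately show ?thesis
    by (simp add: subspace_scale subspace_II)
qed

lemma generator_not_exact: "h 1 * (h 2 * (c 0 * c 2)) - gd x \<notin> II"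
proof -
  have "lam (h 1 * (h 2 * (c 0 * c 2)) - gd x) = 5"
    unfolding lam_simps lam_gd by (subst lam_hhcc) (simp_all add: lam_mon)
  then show ?thesis using lam_II by force
qed

section \<open>Descent to the quotient and to cohomology\<close>

lemma proj_cases: obtains x where "z = proj x"
proof -
  have "\<exists>x. z = abs_dw x" by (induction z rule: dw.abs_induct) auto
  then show ?thesis using that by (auto simp: proj_def)
qed

abbreviation monomial_gca :: "nat list \<Rightarrow> nat list \<Rightarrow> gca" where
  "monomial_gca is js \<equiv> prod_list (map h is) * prod_list (map c js)"

lemma span_monomial:
  "span {monomial is js | is js. P is js} = proj ` span {monomial_gca is js | is js. P is js}"
proof -
  have "{monomial is js | is js. P is js} = proj ` {monomial_gca is js | is js. P is js}"
    by (auto simp: monomial_def)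
  then show ?thesis by (simp add: linear_span_image[OF linear_proj])
qed

text \<open>Peeling off generators also covers unordered or repeated indices, where the product need
  not be a basis element.\<close>

lemma gpart_monomial:
  "gpart A (monomial_gca is js) =
    (if A (int (sum_list is + sum_list js)) (int (length is)) (int (length js))
     then monomial_gca is js else 0)"
proof (induction "is" arbitrary: A)
  case Nil
  show ?case
    by (induction js arbitrary: A) (simp_all add: gpart_one gpart_c algebra_simps)
next
  case (Cons i "is")
  then show ?case by (simp add: gpart_h mult.assoc algebra_simps)
qed

lemma coh_class_scale: "dd x = 0 \<Longrightarrow> coh_class (r *\<^sub>R x) = r *\<^sub>R coh_class x"
  by (simp add: scaleR_coh.abs_eq eq_onp_same_args subspace_0[OF subspace_range_dd])

lemma coh_class_0: "coh_class 0 = 0"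
  by (simp add: zero_coh_def)

text \<open>Take one representative homogeneous in order and one of the given type. Projecting their
  difference to order \<open>n\<close> fixes the first, keeps the type of the second, and sends
  coboundaries to coboundaries.\<close>

lemma coh_ord_type_reduce:
  assumes "u \<in> coh_ord n" "u \<in> coh_type a b"
  obtains y where "y \<in> span {monomial_gca is js | is js.
      sum_list is + sum_list js = n \<and> length is = a \<and> length js = b}"
    "dd (proj y) = 0" "u = coh_class (proj y)"
proof -
  obtain x where x: "u = coh_class (proj x)" "dd (proj x) = 0"
    "x \<in> span {monomial_gca is js | is js. sum_list is + sum_list js = n}"
    using assms(1) unfolding coh_ord_def ord_part_def span_monomial by auto
  obtain y where y: "u = coh_class (proj y)" "dd (proj y) = 0"
    "y \<in> span {monomial_gca is js | is js. length is = a \<and> length js = b}"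
    using assms(2) unfolding coh_type_def type_part_def span_monomial by auto
  obtain z where "proj x - proj y = dd (proj z)"
    using x y coh_class_eq_iff by (metis imageE proj_cases)
  then have xyz: "x - y - gd z \<in> II"
    by (simp add: dd_proj linear_diff[OF linear_proj, symmetric] proj_eq_iff)
  define A :: "int \<Rightarrow> int \<Rightarrow> int \<Rightarrow> bool" where "A m i j \<longleftrightarrow> m = int n" for m i j
  have gd: "gpart A (gd v) = gd (gpart A v)" for v
    by (simp add: gpart_gd A_def[abs_def])
  have Ax: "gpart A x = x"
    using x(3)
  proof (induction rule: span_induct)
    case base
    show ?case by (auto simp: subspace_def gpart_simps)
  next
    case (step v)
    then show ?case by (auto simp: gpart_monomial A_def)
  qed
  have "gpart A y \<in> span {monomial_gca is js | is js.
      sum_list is + sum_list js = n \<and> length is = a \<and> length js = b}" (is "_ \<in> span ?B")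
    using y(3)
  proof (induction rule: span_induct)
    case base
    show ?case
      using linear_subspace_vimage[OF linear_gpart subspace_span] by (simp add: vimage_def)
  next
    case (step v)
    then obtain "is" js where v: "v = monomial_gca is js" "length is = a" "length js = b" by blast
    show ?case
    proof (cases "sum_list is + sum_list js = n")
      case True
      then have "gpart A v = v" by (auto simp: v(1) gpart_monomial A_def)
      moreover have "v \<in> ?B" using v True by blast
      ultimately show ?thesis by (simp add: span_base)
    next
      case False
      then have "\<not> int (sum_list is) + int (sum_list js) = int n" by linarith
      then have "gpart A v = 0" by (simp add: v(1) gpart_monomial A_def)
      then show ?thesis by (simp add: span_zero)
    qed
  qed
  moreover have cocycle: "dd (proj (gpart A y)) = 0"
    using y(2) gpart_II[of "gd y" A] gd[of y] linear_0[OF linear_proj]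
    by (metis dd_proj diff_zero proj_eq_iff)
  moreover have "x - gpart A y - gd (gpart A z) \<in> II"
    using gpart_II[OF xyz, of A] by (simp add: gpart_simps Ax gd)
  then have "proj x - proj (gpart A y) = dd (proj (gpart A z))"
    by (simp add: dd_proj linear_diff[OF linear_proj, symmetric] proj_eq_iff)
  then have "u = coh_class (proj (gpart A y))"
    using x(1,2) cocycle coh_class_eq_iff by (metis rangeI)
  ultimately show ?thesis by (rule that)
qed

lemma type22_order5_class:
  assumes "y \<in> span {monomial_gca is js | is js.
      sum_list is + sum_list js = 5 \<and> length is = 2 \<and> length js = 2}"
  shows "\<exists>r z. y - r *\<^sub>R (h 1 * (h 2 * (c 0 * c 2))) - gd z \<in> II"
proof -
  let ?g = "h 1 * (h 2 * (c 0 * c 2))"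
  \<comment> \<open>The smallest subspace to which \<open>order5_type22\<close> applies: the ideal,
    the coboundaries and the generator.\<close>
  define W where "W = {y. \<exists>r z. y - r *\<^sub>R ?g - gd z \<in> II}"
  have I: "y \<in> W" if "y - r *\<^sub>R ?g - gd z \<in> II" for y r z
    unfolding W_def using that by blast
  have W: "subspace W"
    unfolding subspace_def
  proof (intro conjI ballI allI)
    show "0 \<in> W" by (rule I[of _ 0 0]) (simp add: lin_simps subspace_0[OF subspace_II])
    fix x assume "x \<in> W"
    then obtain r z where x: "x - r *\<^sub>R ?g - gd z \<in> II" unfolding W_def by blast
    show "t *\<^sub>R x \<in> W" for t
      using subspace_scale[OF subspace_II x, of t]
      by (intro I[of _ "t * r" "t *\<^sub>R z"]) (simp add: lin_simps scaleR_diff_right)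
    fix y assume "y \<in> W"
    then obtain s v where y: "y - s *\<^sub>R ?g - gd v \<in> II" unfolding W_def by blast
    show "x + y \<in> W"
      using subspace_add[OF subspace_II x y]
      by (intro I[of _ "r + s" "z + v"]) (simp add: lin_simps scaleR_left_distrib algebra_simps)
  qed
  have "II \<subseteq> W" by (auto intro!: I[of _ 0 0] simp: lin_simps)
  moreover have "gd x \<in> W" for x
    by (rule I[of _ 0 x]) (simp add: subspace_0[OF subspace_II])
  then have "range gd \<subseteq> W" by blast
  moreover have "?g \<in> W"
    by (rule I[of _ 1 0]) (simp add: lin_simps subspace_0[OF subspace_II])
  ultimately have gen: "i + j + k + l = 5 \<Longrightarrow> h i * (h j * (c k * c l)) \<in> W" for i j k l
    by (rule order5_type22[OF W])
  have "{monomial_gca is js | is js. sum_list is + sum_list js = 5 \<and> length is = 2 \<and> length js = 2} \<subseteq> W"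
    using gen by (auto simp: length_Suc_conv numeral_2_eq_2 mult.assoc)
  then have "y \<in> W" using assms W span_minimal by blast
  then show ?thesis by (simp add: W_def)
qed

theorem theorem10p7:
  fixes F V :: "coh set" and w :: dw
  defines "F \<equiv> eigen_part 0 5"
    and "V \<equiv> {u \<in> F. u \<in> coh_type 2 2}"
    and "w \<equiv> proj (h 1 * h 2 * c 0 * c 2)"
  shows "subspace V \<and> (\<exists>\<phi> :: real \<Rightarrow> coh. linear \<phi> \<and> bij_betw \<phi> UNIV V) \<and>
         dd w = 0 \<and> V = span {coh_class w}"
proof -
  let ?g = "h 1 * (h 2 * (c 0 * c 2))"
  have w: "w = proj ?g" by (simp add: w_def mult.assoc)
  have proj_II: "proj x = 0" if "x \<in> II" for x
    using that proj_eq_iff[of x 0] linear_0[OF linear_proj] by simp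
  have dw: "dd w = 0" unfolding w dd_proj by (rule proj_II[OF gd_generator])
  have sw: "dsigma w = 0" unfolding w dsigma_proj by (rule proj_II[OF gsigma_generator])
  \<comment> \<open>Nonvanishing of the class makes the parametrization of \<open>V\<close> by real
    multiples injective.\<close>
  have nz: "coh_class w \<noteq> 0"
  proof
    assume "coh_class w = 0"
    then have "w - 0 \<in> range dd"
      using coh_class_eq_iff[OF dw linear_0[OF linear_dd]] by (simp add: coh_class_0)
    then obtain z where "w = dd (proj z)" by (metis diff_zero imageE proj_cases)
    then have "?g - gd z \<in> II" by (simp add: w dd_proj proj_eq_iff)
    then show False using generator_not_exact by blast
  qed
  have mw: "w = monomial [1, 2] [0, 2]" by (simp add: w monomial_def mult.assoc)
  have "r *\<^sub>R coh_class w \<in> V" for r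
  proof -
    let ?x = "r *\<^sub>R w"
    have u: "r *\<^sub>R coh_class w = coh_class ?x" using dw by (simp add: coh_class_scale)
    have d: "dd ?x = 0" using dw by (simp add: dd_lin)
    have "w \<in> ord_part 5" "w \<in> type_part 2 2"
      unfolding mw ord_part_def type_part_def by (rule span_base; force)+
    then have "coh_class ?x \<in> coh_ord 5" "coh_class ?x \<in> coh_type 2 2"
      using d by (auto simp: coh_ord_def coh_type_def ord_part_def type_part_def
          intro!: exI[of _ ?x] span_scale)
    \<comment> \<open>The eigenvalue condition holds already on representatives, because
      \<open>dsigma w\<close> is zero in the quotient.\<close>
    moreover have "hdelta (hsigma (coh_class ?x)) = 0"
      using d sw hdelta_class[of 0] by (simp add: hsigma_class linear_scale[OF linear_dsigma] dd_lin
          linear_0[OF linear_ddelta] coh_class_0)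
    ultimately show ?thesis by (simp add: u V_def F_def eigen_part_def)
  qed
  moreover have "u \<in> range (\<lambda>r. r *\<^sub>R coh_class w)" if "u \<in> V" for u
  proof -
    have "u \<in> coh_ord 5" "u \<in> coh_type 2 2"
      using that by (simp_all add: V_def F_def eigen_part_def)
    then obtain y where y: "y \<in> span {monomial_gca is js | is js.
        sum_list is + sum_list js = 5 \<and> length is = 2 \<and> length js = 2}"
      "dd (proj y) = 0" "u = coh_class (proj y)"
      by (rule coh_ord_type_reduce)
    obtain r z where "y - r *\<^sub>R ?g - gd z \<in> II"
      using type22_order5_class[OF y(1)] by blast
    then have "proj y - r *\<^sub>R w = dd (proj z)"
      by (simp add: w dd_proj linear_diff[OF linear_proj, symmetric]
          linear_scale[OF linear_proj, symmetric] proj_eq_iff)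
    then have "coh_class (proj y) = coh_class (r *\<^sub>R w)"
      using y(2) dw by (subst coh_class_eq_iff) (auto simp: dd_lin)
    then show ?thesis using dw by (auto simp: y(3) coh_class_scale)
  qed
  ultimately have V: "V = range (\<lambda>r. r *\<^sub>R coh_class w)" by blast
  have "linear (\<lambda>r::real. r *\<^sub>R coh_class w)"
    by (rule linearI) (simp_all add: scaleR_left_distrib)
  moreover have "bij_betw (\<lambda>r::real. r *\<^sub>R coh_class w) UNIV V"
    using nz by (auto simp: V bij_betw_def inj_on_def)
  moreover have "V = span {coh_class w}" by (simp add: V span_singleton)
  ultimately show ?thesis using dw by (metis subspace_span)
qed

end
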